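(* For every positive integer $n$, as an identity of functions of $x$ (wherever both sides are defined), $$F(n,x)=(-1)^{n+1}\frac{\sin (n+1)\theta-\sin n\theta}{\sin (n+2)\theta-\sin (n+1)\theta}=(-1)^{n+1}\frac{\cos\left(\frac{2n+1}{2}\theta\right)}{\cos\left(\frac{2n+3}{2}\theta\right)},$$ where $\theta$ satisfies $\cos\theta=\frac{(-1)^n x}{2}$.
   Context: For a positive integer $m$, let $A_m$ be the $m\times m$ matrix with $(i,j)$ entry $1$ if $i+j\le m+1$ and $0$ otherwise, and $u_m=(1,\dots,1)^T\in\mathbb{R}^m$. For $n\in\mathbb{N}$, $F(n,x)$ is the power series $F(n,x)=1+\sum_{k\ge 0}\left(u_{n+1}^TA_{n+1}^k u_{n+1}\right)x^{k+1}$ (equivalently, the generating function $\sum_{k\ge0}W_k(n)x^k$ where $W_k(n)$ is the number of $(m_1,\dots,m_k)\in\{0,1,\dots,n\}^k$ with $m_i+m_{i+1}\le n$ for all $1\le i<k$); it is a rational function of $x$. *)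

theory Defs
  imports "HOL-Analysis.FPS_Convergence" "Jordan_Normal_Form.Determinant"
begin

(* Indices are shifted: JNF matrices are indexed from 0. *)
definition A_mat :: "nat \<Rightarrow> real mat" where
  "A_mat m = mat m m (\<lambda>(i, j). if (i + 1) + (j + 1) \<le> m + 1 then 1 else 0)"

definition u_vec :: "nat \<Rightarrow> real vec" where
  "u_vec m = vec m (\<lambda>_. 1)"

(* The coefficients are real; they are embedded into the complex numbers so that F can be
   evaluated at complex x. *)
definition F_fps :: "nat \<Rightarrow> complex fps" where
  "F_fps n = 1 + Abs_fps (\<lambda>k. complex_of_real
     (scalar_prod (u_vec (n + 1)) ((A_mat (n + 1) ^\<^sub>m k) *\<^sub>v u_vec (n + 1)))) * fps_X"

text \<open>
  Rational functions given by their power series expansion at 0: \<open>f\<close> is the expansion of \<open>P / Q\<close>.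
  Its value at \<open>x\<close> is \<open>P x / Q x\<close> for any such \<open>P\<close>, \<open>Q\<close> with \<open>Q x \<noteq> 0\<close>; it is
  defined at \<open>x\<close> iff such \<open>P\<close>, \<open>Q\<close> exist, that is, iff \<open>x\<close> is not a pole.
  The value does not depend on \<open>P\<close> and \<open>Q\<close> (\<open>rat_value_eq\<close>), and it is
  the sum of the power series inside the disc of convergence (\<open>rat_value_eq_eval_fps\<close>).
\<close>

definition fps_repr :: "complex fps \<Rightarrow> complex poly \<Rightarrow> complex poly \<Rightarrow> bool" where
  "fps_repr f P Q \<longleftrightarrow> Q \<noteq> 0 \<and> f * fps_of_poly Q = fps_of_poly P"

definition rational_fps :: "complex fps \<Rightarrow> bool" where
  "rational_fps f \<longleftrightarrow> (\<exists>P Q. fps_repr f P Q)"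

definition rat_defined_at :: "complex fps \<Rightarrow> complex \<Rightarrow> bool" where
  "rat_defined_at f x \<longleftrightarrow> (\<exists>P Q. fps_repr f P Q \<and> poly Q x \<noteq> 0)"

definition rat_value :: "complex fps \<Rightarrow> complex \<Rightarrow> complex" where
  "rat_value f x = (THE y. \<exists>P Q. fps_repr f P Q \<and> poly Q x \<noteq> 0 \<and> y = poly P x / poly Q x)"

definition F_defined :: "nat \<Rightarrow> complex \<Rightarrow> bool" where
  "F_defined n x \<longleftrightarrow> rat_defined_at (F_fps n) x"

definition F :: "nat \<Rightarrow> complex \<Rightarrow> complex" where
  "F n x = rat_value (F_fps n) x"

lemma rat_value_eq:
  assumes "fps_repr f P Q" "poly Q x \<noteq> 0"
  shows "rat_value f x = poly P x / poly Q x"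
  unfolding rat_value_def
proof (rule the_equality)
  show "\<exists>P' Q'. fps_repr f P' Q' \<and> poly Q' x \<noteq> 0 \<and> poly P x / poly Q x = poly P' x / poly Q' x"
    using assms by blast
next
  fix y
  assume "\<exists>P' Q'. fps_repr f P' Q' \<and> poly Q' x \<noteq> 0 \<and> y = poly P' x / poly Q' x"
  then obtain P' Q' where r: "fps_repr f P' Q'" "poly Q' x \<noteq> 0" "y = poly P' x / poly Q' x"
    by blast
  have "fps_of_poly (P * Q') = fps_of_poly (P' * Q)"
    using assms(1) r(1) unfolding fps_repr_def fps_of_poly_mult by (metis mult.assoc mult.commute)
  then have "P * Q' = P' * Q"
    by (simp only: fps_of_poly_eq_iff)
  then have "poly P x * poly Q' x = poly P' x * poly Q x"
    by (metis poly_mult)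
  then show "y = poly P x / poly Q x"
    using r assms(2) by (simp add: frac_eq_eq)
qed

lemma rat_value_eq_eval_fps:
  assumes "rat_defined_at f x" "norm x < fps_conv_radius f"
  shows "rat_value f x = eval_fps f x"
proof -
  obtain P Q where r: "fps_repr f P Q" "poly Q x \<noteq> 0"
    using assms(1) unfolding rat_defined_at_def by blast
  have "eval_fps (f * fps_of_poly Q) x = eval_fps f x * eval_fps (fps_of_poly Q) x"
    by (rule eval_fps_mult) (use assms(2) in auto)
  then have "eval_fps f x * poly Q x = poly P x"
    using r(1) by (simp add: fps_repr_def)
  then show ?thesis
    using rat_value_eq[OF r] r(2) by (metis nonzero_mult_div_cancel_right)
qed

lemma rational_F_fps: "rational_fps (F_fps n)"
proof -
  define m where "m = n + 1"
  define v where "v k = (A_mat m ^\<^sub>m k) *\<^sub>v u_vec m" for k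
  define a where "a i j = complex_of_real (A_mat m $$ (i, j))" for i j
  define w where "w k i = complex_of_real (vec_index (v k) i)" for k i
  define G where "G i = Abs_fps (\<lambda>k. w k i)" for i
  define B where "B = mat m m (\<lambda>(i, j). (if i = j then 1 else 0) - monom (a i j) 1)"
  have A: "A_mat m \<in> carrier_mat m m" and u: "u_vec m \<in> carrier_vec m"
    by (auto simp: A_mat_def u_vec_def)
  have B: "B \<in> carrier_mat m m"
    by (simp add: B_def)
  have v_carrier: "v k \<in> carrier_vec m" for k
    unfolding v_def using A u by (metis mult_mat_vec_carrier pow_carrier_mat)
  have v_Suc: "v (Suc k) = A_mat m *\<^sub>v v k" for k
  proof -
    have "A_mat m ^\<^sub>m Suc k = A_mat m * A_mat m ^\<^sub>m k" for k
    proof (induction k)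
      case (Suc k)
      then show ?case using A
        by (metis assoc_mult_mat pow_carrier_mat pow_mat.simps(2))
    qed (use A in simp)
    then show ?thesis
      unfolding v_def using A u by (metis assoc_mult_mat_vec pow_carrier_mat)
  qed
  have w_Suc: "w (Suc k) i = (\<Sum>j<m. a i j * w k j)" if "i < m" for k i
    using that A v_carrier[of k] unfolding w_def v_Suc a_def
    by (auto simp: scalar_prod_def lessThan_atLeast0 intro!: sum.cong)
  have w_0: "w 0 i = 1" if "i < m" for i
    using that A unfolding w_def v_def by (simp add: u_vec_def A_mat_def)
  have BG: "(\<Sum>j<m. fps_of_poly (B $$ (i, j)) * G j) = 1" if i: "i < m" for i
  proof -
    have "(\<Sum>j<m. fps_of_poly (B $$ (i, j)) * G j)
        = (\<Sum>j<m. (if j = i then G j else 0) - fps_X * (fps_const (a i j) * G j))"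
      using i by (intro sum.cong)
        (auto simp: B_def fps_of_poly_diff fps_of_poly_monom algebra_simps)
    also have "\<dots> = G i - fps_X * (\<Sum>j<m. fps_const (a i j) * G j)"
      using i by (simp add: sum_subtractf sum_distrib_left)
    also have "\<dots> = 1"
    proof (rule fps_ext)
      fix k
      show "fps_nth (G i - fps_X * (\<Sum>j<m. fps_const (a i j) * G j)) k = fps_nth 1 k"
        using i by (cases k) (auto simp: G_def w_0 w_Suc fps_sum_nth)
    qed
    finally show ?thesis .
  qed
  define C where "C = adj_mat B"
  define D where "D = Determinant.det B"
  have CB: "(\<Sum>i<m. C $$ (k, i) * B $$ (i, j)) = (if k = j then D else 0)" if "k < m" "j < m" for k j
  proof -
    have "(C * B) $$ (k, j) = (D \<cdot>\<^sub>m 1\<^sub>m m) $$ (k, j)"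
      unfolding C_def D_def using adj_mat(3)[OF B] by simp
    moreover have "(C * B) $$ (k, j) = (\<Sum>i<m. C $$ (k, i) * B $$ (i, j))"
      using that B adj_mat(1)[OF B] unfolding C_def
      by (auto simp: scalar_prod_def lessThan_atLeast0 intro!: sum.cong)
    ultimately show ?thesis using that by simp
  qed
  have DG: "G k * fps_of_poly D = fps_of_poly (\<Sum>i<m. C $$ (k, i))" if k: "k < m" for k
  proof -
    have "fps_of_poly (\<Sum>i<m. C $$ (k, i))
        = (\<Sum>i<m. fps_of_poly (C $$ (k, i)) * (\<Sum>j<m. fps_of_poly (B $$ (i, j)) * G j))"
      by (simp add: BG fps_of_poly_sum)
    also have "\<dots> = (\<Sum>j<m. fps_of_poly (\<Sum>i<m. C $$ (k, i) * B $$ (i, j)) * G j)"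
      by (simp add: fps_of_poly_sum fps_of_poly_mult sum_distrib_left sum_distrib_right mult.assoc)
        (rule sum.swap)
    also have "\<dots> = (\<Sum>j<m. if k = j then fps_of_poly D * G j else 0)"
      using k by (intro sum.cong) (auto simp: CB)
    also have "\<dots> = G k * fps_of_poly D"
      using k by simp
    finally show ?thesis by simp
  qed
  interpret ev: comm_ring_hom "\<lambda>p::complex poly. poly p 0"
    by unfold_locales auto
  have "map_mat (\<lambda>p. poly p 0) B = 1\<^sub>m m"
    by (rule eq_matI) (auto simp: B_def poly_monom)
  then have "poly D 0 = 1"
    using ev.hom_det[of B] by (simp add: D_def)
  then have "D \<noteq> 0" by auto
  have "F_fps n = 1 + (\<Sum>i<m. G i) * fps_X"
  proof -
    have "Abs_fps (\<lambda>k. complex_of_real (scalar_prod (u_vec m) (v k))) = (\<Sum>i<m. G i)"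
    proof (rule fps_ext)
      fix k
      have "scalar_prod (u_vec m) (v k) = (\<Sum>i<m. vec_index (v k) i)"
        using v_carrier[of k]
        by (auto simp: scalar_prod_def u_vec_def lessThan_atLeast0 intro!: sum.cong)
      then show "fps_nth (Abs_fps (\<lambda>k. complex_of_real (scalar_prod (u_vec m) (v k)))) k
          = fps_nth (\<Sum>i<m. G i) k"
        by (simp add: fps_sum_nth G_def w_def)
    qed
    then show ?thesis by (simp add: F_fps_def v_def m_def)
  qed
  then have "F_fps n * fps_of_poly D = fps_of_poly D + (\<Sum>i<m. G i * fps_of_poly D) * fps_X"
    by (simp add: algebra_simps sum_distrib_left sum_distrib_right)
  also have "\<dots> = fps_of_poly D + (\<Sum>i<m. fps_of_poly (\<Sum>j<m. C $$ (i, j))) * fps_of_poly [:0, 1:]"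
    by (simp add: DG)
  also have "\<dots> = fps_of_poly (D + (\<Sum>i<m. \<Sum>j<m. C $$ (i, j)) * [:0, 1:])"
    by (simp only: fps_of_poly_add fps_of_poly_mult fps_of_poly_sum)
  finally show ?thesis
    unfolding rational_fps_def fps_repr_def using \<open>D \<noteq> 0\<close> by blast
qed

end

theory Submission
  imports Defs
begin

text \<open>
  Let \<open>z i\<close> be the generating function of the entries \<open>i\<close> of the vectors \<open>A\<^sup>k u\<close>, and \<open>z (n + 1) = 1\<close>.
  Consecutive rows of \<open>A\<close> differ in a single entry, so \<open>z i = z (i + 1) + x * z (n - i)\<close>, and
  \<open>F = z 0\<close>. In the order \<open>z (n + 1), z 0, z n, z 1, z (n - 1), \<dots>\<close> this becomes a three-term
  recurrence whose two middle entries coincide. Read from the middle outwards it is, up to signs,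
  the recurrence of the Chebyshev polynomials of the third kind
  \<open>cos ((2 k + 1) \<theta> / 2) / cos (\<theta> / 2)\<close> in \<open>2 cos \<theta> = (-1)\<^sup>n x\<close>; the outermost two entries
  have ratio \<open>F\<close>.
\<close>

text \<open>
  \<open>cheb_v (k + 1) (2 * c)\<close> is the value at \<open>c\<close> of the usual Chebyshev polynomial of the third kind of
  degree \<open>k\<close>.
\<close>

fun cheb_v :: "nat \<Rightarrow> 'a::comm_ring_1 \<Rightarrow> 'a" where
  "cheb_v 0 y = 1"
| "cheb_v (Suc 0) y = 1"
| "cheb_v (Suc (Suc k)) y = y * cheb_v (Suc k) y - cheb_v k y"

lemma fps_of_poly_cheb_v: "fps_of_poly (cheb_v k p) = cheb_v k (fps_of_poly p)"
  by (induction k p rule: cheb_v.induct) (simp_all add: fps_of_poly_diff fps_of_poly_mult)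

lemma poly_cheb_v: "poly (cheb_v k p) x = cheb_v k (poly p x)"
  by (induction k p rule: cheb_v.induct) simp_all

text \<open>With \<open>\<phi>\<close> as half angle, the sum of \<open>cos (a + 2 * \<phi>)\<close>
  and \<open>cos (a - 2 * \<phi>)\<close> gives the recurrence of \<open>cheb_v\<close>; the two
  initial values agree because cosine is even. Subtracting outside \<open>of_nat\<close> keeps
  \<open>k = 0\<close> free of truncation.\<close>

lemma cos_eq_cheb_v:
  fixes \<phi> :: complex
  shows "cos (of_nat (2 * k) * \<phi> - \<phi>) = cos \<phi> * cheb_v k (2 * cos (2 * \<phi>))"
proof (induction k "2 * cos (2 * \<phi>)" rule: cheb_v.induct)
  case (3 k)
  let ?a = "of_nat (2 * Suc k) * \<phi> - \<phi>"
  have "cos (?a + 2 * \<phi>) = 2 * cos (2 * \<phi>) * cos ?a - cos (?a - 2 * \<phi>)"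
    by (simp only: cos_add cos_diff) (simp add: algebra_simps)
  moreover have "?a + 2 * \<phi> = of_nat (2 * Suc (Suc k)) * \<phi> - \<phi>"
    and "?a - 2 * \<phi> = of_nat (2 * k) * \<phi> - \<phi>"
    by (simp_all add: algebra_simps)
  ultimately show ?case
    using 3 by (simp add: algebra_simps)
qed simp_all

text \<open>Sines at angles in steps of \<open>\<theta>\<close> obey the recurrence of
  \<open>cheb_v\<close>, hence so do their differences, which equal \<open>sin \<theta>\<close> at
  \<open>k = 0\<close> and \<open>k = 1\<close>.\<close>

lemma sin_diff_eq_cheb_v:
  fixes \<theta> :: complex
  shows "sin (of_nat k * \<theta>) - sin (of_nat k * \<theta> - \<theta>) = sin \<theta> * cheb_v k (2 * cos \<theta>)"
proof (induction k "2 * cos \<theta>" rule: cheb_v.induct)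
  case (3 k)
  let ?a = "of_nat (Suc k) * \<theta>"
  have step: "sin (b + \<theta>) = 2 * cos \<theta> * sin b - sin (b - \<theta>)" for b :: complex
    by (simp add: sin_add sin_diff algebra_simps)
  have eqs: "of_nat (Suc (Suc k)) * \<theta> = ?a + \<theta>" "of_nat (Suc (Suc k)) * \<theta> - \<theta> = (?a - \<theta>) + \<theta>"
    "of_nat k * \<theta> = ?a - \<theta>"
    by (simp_all add: algebra_simps)
  have comb: "A - B = c * (S - T) - (T - U)" if "A = c * S - T" "B = c * T - U"
    for A B c S T U :: complex
    unfolding that by (simp add: algebra_simps)
  have "sin (of_nat (Suc (Suc k)) * \<theta>) - sin (of_nat (Suc (Suc k)) * \<theta> - \<theta>)
      = 2 * cos \<theta> * (sin ?a - sin (?a - \<theta>)) - (sin (of_nat k * \<theta>) - sin (of_nat k * \<theta> - \<theta>))"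
    unfolding eqs(2) unfolding eqs(1,3) by (rule comb) (rule step)+
  then show ?case
    using 3 by (simp add: algebra_simps)
qed simp_all

text \<open>Solving for \<open>s j\<close> runs the recurrence backwards from two equal entries,
  matching the equal initial values of \<open>cheb_v\<close>. The alternating signs collect in
  \<open>(-1) ^ (k div 2)\<close>.\<close>

lemma three_term_recurrence_from_middle:
  fixes s :: "nat \<Rightarrow> 'a::comm_ring_1"
  assumes rec: "\<And>j. j \<le> n \<Longrightarrow> s (j + 2) = s j + (-1) ^ j * x * s (j + 1)"
    and mid: "s (n + 1) = s (n + 2)"
    and "k \<le> n + 2"
  shows "s (n + 2 - k) = (-1) ^ (k div 2) * cheb_v k ((-1) ^ n * x) * s (n + 2)"
  using \<open>k \<le> n + 2\<close>
proof (induction k "(-1) ^ n * x" rule: cheb_v.induct)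
  case (3 k)
  then have k: "k \<le> n" by simp
  have "s (n - k) = s (n + 2 - k) - (-1) ^ (n - k) * x * s (n + 2 - Suc k)"
    using rec[of "n - k"] k by (simp add: Suc_diff_le)
  also have "(-1) ^ (n - k) = (-1) ^ n * ((-1) ^ k :: 'a)"
    using k by (cases "even n"; cases "even k") auto
  also have "s (n + 2 - k) - (-1) ^ n * (-1) ^ k * x * s (n + 2 - Suc k)
      = (-1) ^ (k div 2) * cheb_v k ((-1) ^ n * x) * s (n + 2)
        - (-1) ^ (Suc k div 2) * (-1) ^ k * ((-1) ^ n * x * cheb_v (Suc k) ((-1) ^ n * x)) * s (n + 2)"
    using 3 by (simp only: mult_ac)
  \<comment> \<open>For odd \<open>k\<close> the exponent \<open>Suc k div 2\<close> exceeds
    \<open>k div 2\<close> by one, and \<open>(-1) ^ k\<close> cancels the extra sign.\<close>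
  also have "(-1) ^ (Suc k div 2) * (-1) ^ k = ((-1) ^ (k div 2) :: 'a)"
    by (cases "even k") (auto elim!: evenE oddE simp flip: power_add)
  finally show ?case
    by (simp add: algebra_simps)
qed (use mid in simp_all)

text \<open>Up to sign, \<open>a\<close> is the middle entry. Writing both ends as multiples of it
  avoids division, so the lemma applies to power series.\<close>

lemma reflected_recurrence:
  fixes z :: "nat \<Rightarrow> 'a::comm_ring_1"
  assumes z: "\<And>i. i \<le> n \<Longrightarrow> z i = z (Suc i) + x * z (n - i)"
  obtains a where "z (Suc n) = cheb_v (n + 2) ((-1) ^ n * x) * a"
    and "z 0 = (-1) ^ (n + 1) * cheb_v (n + 1) ((-1) ^ n * x) * a"
proof -
  \<comment> \<open>Even positions run down from \<open>z (Suc n)\<close>, odd ones up from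
    \<open>z 0\<close>. At \<open>j = 2 * i\<close> the recurrence is the assumption at
    \<open>n - i\<close>; at \<open>j = 2 * i + 1\<close> it is the assumption at \<open>i\<close>,
    solved for \<open>z (Suc i)\<close>.\<close>
  define s where "s j = (if even j then z (Suc n - j div 2) else z (j div 2))" for j
  have rec: "s (j + 2) = s j + (-1) ^ j * x * s (j + 1)" if "j \<le> n" for j
  proof (cases "even j")
    case True
    then obtain i where i: "j = 2 * i" by blast
    then have "i \<le> n" using that by simp
    then show ?thesis
      using z[of "n - i"] i by (simp add: s_def Suc_diff_le)
  next
    case False
    then obtain i where i: "j = 2 * i + 1" by (rule oddE)
    then have "i \<le> n" using that by simp
    then show ?thesis
      using z[of i] i by (simp add: s_def)
  qed
  \<comment> \<open>The descending and ascending halves meet here at the same index of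
    \<open>z\<close>.\<close>
  have mid: "s (n + 1) = s (n + 2)"
    by (cases "even n") (auto elim!: evenE oddE simp: s_def)
  have eq: "s (n + 2 - k) = (-1) ^ (k div 2) * cheb_v k ((-1) ^ n * x) * s (n + 2)"
    if "k \<le> n + 2" for k
    using three_term_recurrence_from_middle[OF rec mid that] .
  define a where "a = (-1) ^ ((n + 2) div 2) * s (n + 2)"
  have "z (Suc n) = cheb_v (n + 2) ((-1) ^ n * x) * a"
    using eq[of "n + 2"] by (simp add: s_def a_def algebra_simps)
  moreover have "(-1) ^ ((n + 1) div 2) = (-1) ^ (n + 1) * ((-1) ^ ((n + 2) div 2) :: 'a)"
    by (cases "even n") (auto elim!: evenE oddE simp flip: power_add)
  then have "z 0 = (-1) ^ (n + 1) * cheb_v (n + 1) ((-1) ^ n * x) * a"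
    using eq[of "n + 1"] by (simp add: s_def a_def algebra_simps)
  ultimately show ?thesis by (rule that)
qed

lemma A_mat_mult_index:
  assumes "v \<in> carrier_vec (n + 1)" "i \<le> n"
  shows "vec_index (A_mat (n + 1) *\<^sub>v v) i = (\<Sum>j<Suc n - i. vec_index v j)"
proof -
  have "vec_index (A_mat (n + 1) *\<^sub>v v) i
      = (\<Sum>j<Suc n. (if j < Suc n - i then vec_index v j else 0))"
    using assms
    by (auto simp: A_mat_def scalar_prod_def lessThan_atLeast0 intro!: sum.cong)
  also have "\<dots> = (\<Sum>j | j \<in> {..<Suc n} \<and> j < Suc n - i. vec_index v j)"
    by (rule sum.inter_filter[symmetric]) simp
  also have "{j. j \<in> {..<Suc n} \<and> j < Suc n - i} = {..<Suc n - i}"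
    by auto
  finally show ?thesis .
qed

lemma pow_mat_Suc_left:
  assumes "A \<in> carrier_mat m m"
  shows "A ^\<^sub>m Suc k = A * A ^\<^sub>m k"
proof (induction k)
  case (Suc k)
  then show ?case using assms
    by (metis assoc_mult_mat pow_carrier_mat pow_mat.simps(2))
qed (use assms in simp)

lemma F_fps_repr:
  fixes n :: nat
  defines "y \<equiv> [:0, (-1) ^ n:]"
  shows "fps_repr (F_fps n) ((-1) ^ (n + 1) * cheb_v (n + 1) y) (cheb_v (n + 2) y)"
proof -
  define v where "v k = (A_mat (n + 1) ^\<^sub>m k) *\<^sub>v u_vec (n + 1)" for k
  define G where "G i = Abs_fps (\<lambda>k. complex_of_real (vec_index (v k) i))" for i
  \<comment> \<open>This agrees with \<open>G i\<close> for \<open>i \<le> n\<close> and extends it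
    by the empty sum to \<open>z (Suc n) = 1\<close>.\<close>
  define z where "z i = 1 + fps_X * (\<Sum>j<Suc n - i. G j)" for i
  have A: "A_mat (n + 1) \<in> carrier_mat (n + 1) (n + 1)" and u: "u_vec (n + 1) \<in> carrier_vec (n + 1)"
    by (auto simp: A_mat_def u_vec_def)
  have v_carrier: "v k \<in> carrier_vec (n + 1)" for k
    unfolding v_def using A u by (metis mult_mat_vec_carrier pow_carrier_mat)
  have v_0: "v 0 = u_vec (n + 1)"
    using A u by (simp add: v_def)
  have v_Suc: "v (Suc k) = A_mat (n + 1) *\<^sub>v v k" for k
    unfolding v_def pow_mat_Suc_left[OF A] using A u by (metis assoc_mult_mat_vec pow_carrier_mat)
  have G_eq: "G i = z i" if "i \<le> n" for i
  proof (rule fps_ext)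
    fix k
    show "fps_nth (G i) k = fps_nth (z i) k"
      using that A_mat_mult_index[OF v_carrier that]
      by (cases k) (auto simp: G_def z_def v_0 u_vec_def v_Suc fps_sum_nth)
  qed
  have "z i = z (Suc i) + fps_X * z (n - i)" if "i \<le> n" for i
  proof -
    have "z i = z (Suc i) + fps_X * G (n - i)"
      using that by (simp add: z_def Suc_diff_le algebra_simps)
    then show ?thesis by (simp add: G_eq)
  qed
  then obtain a where a: "z (Suc n) = cheb_v (n + 2) ((-1) ^ n * fps_X) * a"
    "z 0 = (-1) ^ (n + 1) * cheb_v (n + 1) ((-1) ^ n * fps_X) * a"
    by (rule reflected_recurrence)
  have "Abs_fps (\<lambda>k. complex_of_real (scalar_prod (u_vec (n + 1)) (v k))) = (\<Sum>i<Suc n. G i)"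
  proof (rule fps_ext)
    fix k
    have "scalar_prod (u_vec (n + 1)) (v k) = (\<Sum>i<Suc n. vec_index (v k) i)"
      using v_carrier[of k]
      by (auto simp: scalar_prod_def u_vec_def lessThan_atLeast0 intro!: sum.cong)
    then show "fps_nth (Abs_fps (\<lambda>k. complex_of_real (scalar_prod (u_vec (n + 1)) (v k)))) k
        = fps_nth (\<Sum>i<Suc n. G i) k"
      by (simp add: fps_sum_nth G_def)
  qed
  then have F: "F_fps n = z 0"
    by (simp add: F_fps_def z_def v_def mult.commute)
  have sgn: "fps_of_poly ((-1) ^ k) = (-1 :: complex fps) ^ k" for k
    by (simp add: fps_of_poly_power fps_of_poly_uminus)
  have "y = (-1) ^ n * [:0, 1:]"
    unfolding y_def by (cases "even n") simp_all
  then have y: "fps_of_poly y = (-1) ^ n * fps_X"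
    by (simp only: fps_of_poly_mult sgn fps_of_poly_fps_X)
  \<comment> \<open>Since \<open>z (Suc n) = 1\<close>, the series \<open>a\<close> is the inverse
    of the denominator.\<close>
  have 1: "fps_of_poly (cheb_v (n + 2) y) * a = 1"
    using a(1) unfolding fps_of_poly_cheb_v y by (simp add: z_def del: cheb_v.simps)
  then have "cheb_v (n + 2) y \<noteq> 0"
    by auto
  moreover have "F_fps n * fps_of_poly (cheb_v (n + 2) y)
      = fps_of_poly ((-1) ^ (n + 1) * cheb_v (n + 1) y) * (fps_of_poly (cheb_v (n + 2) y) * a)"
    unfolding F a(2) fps_of_poly_mult sgn fps_of_poly_cheb_v y by (simp only: mult_ac)
  ultimately show ?thesis
    unfolding fps_repr_def 1 by simp
qed

lemma F_eq_cheb_v: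
  assumes "cheb_v (n + 2) ((-1) ^ n * x) \<noteq> 0"
  shows "F n x = (-1) ^ (n + 1) * (cheb_v (n + 1) ((-1) ^ n * x) / cheb_v (n + 2) ((-1) ^ n * x))"
proof -
  have y: "poly [:0, (-1) ^ n:] x = (-1) ^ n * x"
    by simp
  have "poly (cheb_v (n + 2) [:0, (-1) ^ n:]) x \<noteq> 0"
    using assms unfolding poly_cheb_v y .
  from rat_value_eq[OF F_fps_repr this] show ?thesis
    unfolding F_def poly_cheb_v y poly_mult by (simp add: poly_cheb_v)
qed

theorem theorem1p5:
  fixes n :: nat and x \<theta> :: complex
  assumes "n > 0"
    and "cos \<theta> = (-1) ^ n * x / 2"
  shows "(F_defined n x \<and> sin (of_nat (n + 2) * \<theta>) - sin (of_nat (n + 1) * \<theta>) \<noteq> 0 \<longrightarrow>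
            F n x = (-1) ^ (n + 1) *
              ((sin (of_nat (n + 1) * \<theta>) - sin (of_nat n * \<theta>)) /
               (sin (of_nat (n + 2) * \<theta>) - sin (of_nat (n + 1) * \<theta>))))
       \<and> (F_defined n x \<and> cos (of_nat (2 * n + 3) / 2 * \<theta>) \<noteq> 0 \<longrightarrow>
            F n x = (-1) ^ (n + 1) *
              (cos (of_nat (2 * n + 1) / 2 * \<theta>) / cos (of_nat (2 * n + 3) / 2 * \<theta>)))
       \<and> (sin (of_nat (n + 2) * \<theta>) - sin (of_nat (n + 1) * \<theta>) \<noteq> 0 \<and>
            cos (of_nat (2 * n + 3) / 2 * \<theta>) \<noteq> 0 \<longrightarrow>
            (-1) ^ (n + 1) *
              ((sin (of_nat (n + 1) * \<theta>) - sin (of_nat n * \<theta>)) /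
               (sin (of_nat (n + 2) * \<theta>) - sin (of_nat (n + 1) * \<theta>)))
            = (-1) ^ (n + 1) *
              (cos (of_nat (2 * n + 1) / 2 * \<theta>) / cos (of_nat (2 * n + 3) / 2 * \<theta>)))"
proof -
  have y: "(-1) ^ n * x = 2 * cos \<theta>"
    by (simp add: assms(2))
  let ?V = "\<lambda>k. cheb_v k (2 * cos \<theta>)"
  have sin_diff: "sin (of_nat (Suc k) * \<theta>) - sin (of_nat k * \<theta>) = sin \<theta> * ?V (Suc k)" for k
    using sin_diff_eq_cheb_v[of "Suc k" \<theta>] by (simp add: algebra_simps)
  have cos: "cos (of_nat (2 * k + 1) / 2 * \<theta>) = cos (\<theta> / 2) * ?V (Suc k)" for k
  proof -
    have "of_nat (2 * k + 1) / 2 * \<theta> = of_nat (2 * Suc k) * (\<theta> / 2) - \<theta> / 2"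
      by (simp add: field_simps)
    then show ?thesis
      using cos_eq_cheb_v[of "Suc k" "\<theta> / 2"] by (simp only:) simp
  qed
  have sins: "sin (of_nat (n + 1) * \<theta>) - sin (of_nat n * \<theta>) = sin \<theta> * ?V (n + 1)"
    "sin (of_nat (n + 2) * \<theta>) - sin (of_nat (n + 1) * \<theta>) = sin \<theta> * ?V (n + 2)"
    using sin_diff[of n] sin_diff[of "n + 1"] by simp_all
  have coss: "cos (of_nat (2 * n + 1) / 2 * \<theta>) = cos (\<theta> / 2) * ?V (n + 1)"
    "cos (of_nat (2 * n + 3) / 2 * \<theta>) = cos (\<theta> / 2) * ?V (n + 2)"
    using cos[of n] cos[of "n + 1"] by (simp_all add: algebra_simps numeral_3_eq_3)
  have F: "F n x = (-1) ^ (n + 1) * (?V (n + 1) / ?V (n + 2))" if "?V (n + 2) \<noteq> 0"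
    using F_eq_cheb_v[of n x] that unfolding y .
  show ?thesis
    \<comment> \<open>A nonzero denominator forces both of its factors to be nonzero:
      \<open>F\<close> applies, and \<open>sin \<theta>\<close> or \<open>cos (\<theta> / 2)\<close>
      cancels.\<close>
    unfolding sins coss using F by (auto simp del: cheb_v.simps power_Suc)
qed

end
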